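(* Let $1\le t\le s-1$, and let $M=(m_{ij})$ be the $s\times s$ $0$-$1$ matrix with $m_{ii}=0$ for $2\le i\le s$ and all other entries (including $m_{11}$) equal to $1$. If $t$ is odd, then \[N_t(M)=\binom{s-1}{t-1}\bigl(1+(s-t+1)(s-t)\bigr).\] If $t$ is even, then \[N_t(M)=\binom{s-1}{t}+\binom{s-1}{t-1}\bigl(1+(s-t+1)(s-t)\bigr).\]
   Context: For a $0$-$1$ matrix $M$ of size $s\times s$ and $1\le t\le s$, $N_t(M)$ is the number of $t\times t$ submatrices of $M$ (one for each choice of a $t$-subset of rows and a $t$-subset of columns) that are invertible over $\mathbb{F}_2$. *)

theory Defs
  imports
    "Jordan_Normal_Form.Matrix"
    "Jordan_Normal_Form.DL_Submatrix"
    "HOL-Library.Z2"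
begin

text \<open>
  A 0-1 matrix is represented by a matrix over \<^typ>\<open>nat\<close>; the type \<^typ>\<open>bit\<close> is the
  two-element field, and the entries are reduced into it before invertibility is tested.
  Each pair of a \<open>t\<close>-subset of row indices and a \<open>t\<close>-subset of column indices is counted
  separately, even if two pairs yield equal submatrices. Indices start at 0.
\<close>

definition num_inv_submat :: "nat \<Rightarrow> nat mat \<Rightarrow> nat" where
  "num_inv_submat t M =
     card {(I, J). I \<subseteq> {..<dim_row M} \<and> card I = t \<and>
                   J \<subseteq> {..<dim_col M} \<and> card J = t \<and>
                   invertible_mat (map_mat of_nat (submatrix M I J) :: bit mat)}"

end

theory Submission
  imports Defs "Jordan_Normal_Form.Determinant"
begin

text \<open>
  Over \<open>\<F>\<^sub>2\<close> the submatrix on rows \<open>I\<close> and columns \<open>J\<close> is the all-ones matrix plus a partial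
  identity supported on \<open>D = I \<inter> J - {0}\<close>, so it maps \<open>f\<close> to \<open>S - f i\<close> on the rows \<open>i \<in> D\<close> and
  to \<open>S\<close> on the others, where \<open>S\<close> is the sum of \<open>f\<close> over \<open>J\<close>. If \<open>J\<close> has two elements
  outside \<open>D\<close>, their indicator lies in the kernel. If there is exactly one row outside \<open>D\<close>, it forces
  \<open>S = 0\<close> and then \<open>f = 0\<close>. If \<open>I = J = D\<close>, a kernel vector is constantly equal to \<open>S = t S\<close>, so the
  kernel is trivial exactly when \<open>t\<close> is even. Counting the pairs with \<open>|D| = t - 1\<close>,
  and with \<open>|D| = t\<close> when \<open>t\<close> is even, gives the formula.
\<close>

section \<open>Invertibility of a submatrix as triviality of its kernel\<close>

lemma invertible_mat_iff_det:
  fixes A :: "'a :: field mat"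
  assumes A: "A \<in> carrier_mat n n"
  shows "invertible_mat A \<longleftrightarrow> det A \<noteq> 0"
proof
  assume "invertible_mat A"
  then obtain B where B: "inverts_mat A B" "inverts_mat B A"
    by (auto simp: invertible_mat_def)
  have AB: "A * B = 1\<^sub>m n" using B(1) A by (simp add: inverts_mat_def)
  have BA: "B * A = 1\<^sub>m (dim_row B)" using B(2) by (simp add: inverts_mat_def)
  \<comment> \<open>\<open>invertible_mat\<close> does not fix the size of the inverse; counting
    columns in the two product equations shows that \<open>B\<close> is n by n.\<close>
  have "dim_col B = n" using arg_cong[OF AB, of dim_col] by simp
  moreover have "dim_row B = n" using arg_cong[OF BA, of dim_col] A by simp
  ultimately have "B \<in> carrier_mat n n" by auto
  with AB A have "det A * det B = 1" by (metis det_mult det_one)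
  then show "det A \<noteq> 0" by auto
next
  assume "det A \<noteq> 0"
  from det_non_zero_imp_unit[OF A this, of "()"]
  obtain B where "B \<in> carrier_mat n n" "A * B = 1\<^sub>m n" "B * A = 1\<^sub>m n"
    by (auto simp: Units_def ring_mat_def)
  then show "invertible_mat A"
    using A by (auto simp: invertible_mat_def inverts_mat_def intro!: exI[of _ B])
qed

text \<open>Since \<open>pick J\<close> is strictly increasing below \<open>card J\<close> and takes
  values in \<open>J\<close>, a cardinality count makes it onto.\<close>

lemma bij_betw_pick:
  assumes "finite J"
  shows "bij_betw (pick J) {..<card J} J"
proof -
  have "inj_on (pick J) {..<card J}"
    by (rule linorder_inj_onI) (auto dest: pick_mono_le[of _ J])
  moreover have "pick J ` {..<card J} \<subseteq> J" using pick_in_set_le by auto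
  ultimately show ?thesis
    using assms by (auto simp: bij_betw_def card_image card_subset_eq)
qed

text \<open>A square matrix over a field is invertible iff its kernel is trivial. Reindexing rows
  and columns along \<open>pick\<close> turns kernel vectors into functions on \<open>J\<close>, so
  that positions inside the submatrix disappear from all later arguments.\<close>

lemma invertible_submatrix_iff:
  fixes M :: "nat mat"
  assumes I: "I \<subseteq> {..<dim_row M}" "card I = t" and J: "J \<subseteq> {..<dim_col M}" "card J = t"
  shows "invertible_mat (map_mat of_nat (submatrix M I J) :: bit mat) \<longleftrightarrow>
    (\<forall>f. (\<forall>i\<in>I. (\<Sum>j\<in>J. of_nat (M $$ (i, j)) * f j) = (0::bit)) \<longrightarrow> (\<forall>j\<in>J. f j = 0))"
    (is "invertible_mat ?A \<longleftrightarrow> ?R")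
proof -
  have fin: "finite I" "finite J" using I J finite_subset by blast+
  have eqs: "{i. i < dim_row M \<and> i \<in> I} = I" "{j. j < dim_col M \<and> j \<in> J} = J"
    using I J by auto
  have A: "?A \<in> carrier_mat t t" using I J by (auto simp: dim_submatrix eqs)
  have bI: "bij_betw (pick I) {..<t} I" and bJ: "bij_betw (pick J) {..<t} J"
    using bij_betw_pick fin I J by metis+
  have pick_I: "pick I k \<in> I" if "k < t" for k using that I pick_in_set_le by blast
  have imI: "\<exists>k<t. i = pick I k" if "i \<in> I" for i
    using that bI by (force simp: bij_betw_def)
  have imJ: "\<exists>k<t. j = pick J k" if "j \<in> J" for j
    using that bJ by (force simp: bij_betw_def)
  have ent: "?A $$ (i, j) = of_nat (M $$ (pick I i, pick J j))" if "i < t" "j < t" for i j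
    using that A I J by (simp add: submatrix_index eqs dim_submatrix)
  \<comment> \<open>The map \<open>the_inv_into {..<t} (pick J)\<close> sends a column index in
    \<open>J\<close> to its position in the submatrix.\<close>
  have mv: "(?A *\<^sub>v v) $ i = (\<Sum>j\<in>J. of_nat (M $$ (pick I i, j)) * v $ the_inv_into {..<t} (pick J) j)"
    if "i < t" "v \<in> carrier_vec t" for v i
  proof -
    have "(?A *\<^sub>v v) $ i = (\<Sum>j<t. ?A $$ (i, j) * v $ j)"
      using that A by (simp add: scalar_prod_def lessThan_atLeast0)
    also have "\<dots> = (\<Sum>j<t. of_nat (M $$ (pick I i, pick J j)) * v $ the_inv_into {..<t} (pick J) (pick J j))"
      using that bJ by (intro sum.cong) (auto simp: ent the_inv_into_f_f bij_betw_def)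
    also have "\<dots> = (\<Sum>j\<in>J. of_nat (M $$ (pick I i, j)) * v $ the_inv_into {..<t} (pick J) j)"
      by (rule sum.reindex_bij_betw[OF bJ])
    finally show ?thesis .
  qed
  have "invertible_mat ?A \<longleftrightarrow> (\<forall>v \<in> carrier_vec t. ?A *\<^sub>v v = 0\<^sub>v t \<longrightarrow> v = 0\<^sub>v t)"
    using invertible_mat_iff_det[OF A] det_0_iff_vec_prod_zero_field[OF A] by blast
  also have "\<dots> \<longleftrightarrow> ?R"
  proof
    assume L: "\<forall>v \<in> carrier_vec t. ?A *\<^sub>v v = 0\<^sub>v t \<longrightarrow> v = 0\<^sub>v t"
    show ?R
    proof (intro allI impI)
      fix f assume f: "\<forall>i\<in>I. (\<Sum>j\<in>J. of_nat (M $$ (i, j)) * f j) = (0::bit)"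
      define v where "v = vec t (\<lambda>k. f (pick J k))"
      have v: "v \<in> carrier_vec t" by (simp add: v_def)
      have vf: "v $ the_inv_into {..<t} (pick J) j = f j" if "j \<in> J" for j
      proof -
        obtain k where "k < t" "j = pick J k" using imJ[OF \<open>j \<in> J\<close>] by blast
        then show ?thesis using bJ by (simp add: v_def the_inv_into_f_f bij_betw_def)
      qed
      have "?A *\<^sub>v v = 0\<^sub>v t"
      proof (rule eq_vecI)
        fix i assume "i < dim_vec (0\<^sub>v t :: bit vec)"
        then have i: "i < t" by simp
        then have "pick I i \<in> I" by (rule pick_I)
        with f i v show "(?A *\<^sub>v v) $ i = 0\<^sub>v t $ i" by (simp add: mv vf cong: sum.cong)
      qed (use A in auto)
      with L v have "v = 0\<^sub>v t" by blast
      then have "f (pick J k) = 0" if "k < t" for k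
        using that by (metis index_vec index_zero_vec(1) v_def)
      then show "\<forall>j\<in>J. f j = 0" using imJ by auto
    qed
  next
    assume R: ?R
    show "\<forall>v \<in> carrier_vec t. ?A *\<^sub>v v = 0\<^sub>v t \<longrightarrow> v = 0\<^sub>v t"
    proof (intro ballI impI)
      fix v assume v: "v \<in> carrier_vec t" and z: "?A *\<^sub>v v = 0\<^sub>v t"
      define f where "f = (\<lambda>j. v $ the_inv_into {..<t} (pick J) j)"
      have "(\<Sum>j\<in>J. of_nat (M $$ (pick I k, j)) * f j) = 0" if "k < t" for k
        using mv[OF that v] z that by (simp add: f_def)
      then have "\<forall>i\<in>I. (\<Sum>j\<in>J. of_nat (M $$ (i, j)) * f j) = 0" using imI by metis
      with R have "\<forall>j\<in>J. f j = 0" by blast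
      moreover have "f (pick J k) = v $ k" if "k < t" for k
        using that bJ by (simp add: f_def the_inv_into_f_f bij_betw_def)
      ultimately have "v $ k = 0" if "k < t" for k using that J pick_in_set_le by metis
      with v show "v = 0\<^sub>v t" by auto
    qed
  qed
  finally show ?thesis .
qed

section \<open>Kernels of the submatrices of the given matrix\<close>

abbreviation holed_ones_mat :: "nat \<Rightarrow> nat mat" where
  "holed_ones_mat s \<equiv> mat s s (\<lambda>(i, j). if i = j \<and> 1 \<le> i then 0 else 1)"

lemma holed_ones_mat_row_sum:
  fixes f :: "nat \<Rightarrow> bit"
  assumes "i < s" "J \<subseteq> {..<s}"
  shows "(\<Sum>j\<in>J. of_nat (holed_ones_mat s $$ (i, j)) * f j) =
    sum f J - (if i \<in> J \<and> 1 \<le> i then f i else 0)"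
proof -
  have fin: "finite J" using assms finite_subset by blast
  \<comment> \<open>A zero entry is written as one minus a Kronecker delta, so only the term at
    \<open>j = i\<close> has to be removed from the full sum.\<close>
  have "(\<Sum>j\<in>J. of_nat (holed_ones_mat s $$ (i, j)) * f j) =
      (\<Sum>j\<in>J. f j - (if i = j then if 1 \<le> i then f i else 0 else 0))"
    using assms by (intro sum.cong) auto
  also have "\<dots> = sum f J - (if i \<in> J \<and> 1 \<le> i then f i else 0)"
    unfolding sum_subtractf sum.delta'[OF fin] by (intro arg_cong2[of _ _ _ _ minus]) auto
  finally show ?thesis .
qed

lemma of_nat_bit_eq_0_iff: "(of_nat n :: bit) = 0 \<longleftrightarrow> even n"
  by (induction n) (auto simp: bit_not_zero_iff)

lemma holed_ones_submatrix_invertible_iff: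
  assumes I: "I \<subseteq> {..<s}" "card I = t" and J: "J \<subseteq> {..<s}" "card J = t" and t: "1 \<le> t"
  defines "D \<equiv> I \<inter> J - {0}"
  shows "invertible_mat (map_mat of_nat (submatrix (holed_ones_mat s) I J) :: bit mat) \<longleftrightarrow>
    card D = t - 1 \<or> even t \<and> I = J \<and> 0 \<notin> I"
    (is "?L \<longleftrightarrow> _")
proof -
  have fin: "finite I" "finite J" using I J finite_subset by blast+
  then have finD: "finite D" by (simp add: D_def)
  have cardD: "card (I - D) = t - card D" "card (J - D) = t - card D" "card D \<le> t"
  proof -
    have "D \<subseteq> I" "D \<subseteq> J" by (auto simp: D_def)
    then show "card (I - D) = t - card D" "card (J - D) = t - card D" "card D \<le> t"
      using fin finD I(2) J(2) card_mono[of I D] card_Diff_subset[of D] by simp_all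
  qed
  have L: "?L \<longleftrightarrow> (\<forall>f :: nat \<Rightarrow> bit.
      (\<forall>i\<in>I. sum f J = (if i \<in> D then f i else 0)) \<longrightarrow> (\<forall>j\<in>J. f j = 0))"
  proof -
    have row: "(\<Sum>j\<in>J. of_nat (holed_ones_mat s $$ (i, j)) * f j) = 0 \<longleftrightarrow>
        sum f J = (if i \<in> D then f i else 0)" if "i \<in> I" for i and f :: "nat \<Rightarrow> bit"
    proof -
      have "i < s" using that I by auto
      moreover have "i \<in> J \<and> 1 \<le> i \<longleftrightarrow> i \<in> D" using that by (auto simp: D_def)
      ultimately show ?thesis
        by (simp only: holed_ones_mat_row_sum[OF _ J(1)] right_minus_eq)
    qed
    have "?L \<longleftrightarrow> (\<forall>f :: nat \<Rightarrow> bit.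
      (\<forall>i\<in>I. (\<Sum>j\<in>J. of_nat (holed_ones_mat s $$ (i, j)) * f j) = 0) \<longrightarrow> (\<forall>j\<in>J. f j = 0))"
      using I J by (intro invertible_submatrix_iff) auto
    also have "\<dots> \<longleftrightarrow> (\<forall>f :: nat \<Rightarrow> bit.
      (\<forall>i\<in>I. sum f J = (if i \<in> D then f i else 0)) \<longrightarrow> (\<forall>j\<in>J. f j = 0))"
      using row by (simp cong: ball_cong)
    finally show ?thesis .
  qed
  \<comment> \<open>The cases are 0, 1 or at least 2 columns outside \<open>D\<close>, because
    \<open>card (J - D) = t - card D\<close>.\<close>
  consider "card D = t" | "card D = t - 1" "card D \<noteq> t" | "2 \<le> card (J - D)"
    using cardD by linarith
  then show ?thesis
  proof cases
    case 1
    moreover have "D \<subseteq> I" "D \<subseteq> J" by (auto simp: D_def)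
    ultimately have "D = I" "D = J"
      using fin I J by (metis card_subset_eq)+
    then have IJ: "I = J" "0 \<notin> I" and D: "D = J" by (auto simp: D_def)
    have "?L \<longleftrightarrow> even t"
    proof
      assume ?L
      show "even t"
      proof (rule ccontr)
        assume "odd t"
        then have "of_nat t = (1::bit)" by (metis bit_not_zero_iff of_nat_bit_eq_0_iff)
        \<comment> \<open>For odd \<open>t\<close> the constant 1 is a kernel vector: its sum over
          \<open>J\<close> is \<open>t\<close>, which is 1 in the field.\<close>
        then have "\<forall>i\<in>I. sum (\<lambda>_. 1::bit) J = (if i \<in> D then 1 else 0)"
          using D IJ J by simp
        with \<open>?L\<close> have "\<forall>j\<in>J. (1::bit) = 0" unfolding L by blast
        with J t show False by auto
      qed
    next
      assume "even t"
      show ?L unfolding L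
      proof (intro allI impI)
        fix f :: "nat \<Rightarrow> bit" assume f: "\<forall>i\<in>I. sum f J = (if i \<in> D then f i else 0)"
        then have c: "\<forall>j\<in>J. f j = sum f J" using D IJ by simp
        then have "sum f J = of_nat t * sum f J" using J by (metis sum_constant sum.cong)
        with \<open>even t\<close> have "sum f J = 0" by (metis of_nat_bit_eq_0_iff mult_zero_left)
        with c show "\<forall>j\<in>J. f j = 0" by simp
      qed
    qed
    then show ?thesis using 1 IJ t by auto
  next
    case 2
    then obtain i0 j0 where i0: "I - D = {i0}" and j0: "J - D = {j0}"
      using cardD t by (metis card_1_singletonE diff_diff_cancel)
    have ?L unfolding L
    proof (intro allI impI)
      fix f :: "nat \<Rightarrow> bit" assume f: "\<forall>i\<in>I. sum f J = (if i \<in> D then f i else 0)"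
      \<comment> \<open>This is the equation of row \<open>i0\<close>. The other rows then make
        \<open>f\<close> vanish on \<open>D\<close>, so \<open>f j0\<close> is all that is left of
        the sum.\<close>
      then have S: "sum f J = 0" using i0 by force
      with f have fD: "f j = 0" if "j \<in> D" for j using that by (auto simp: D_def)
      have "sum f J = sum f {j0}"
        using fin fD j0 by (intro sum.mono_neutral_right) auto
      with S have "f j0 = 0" by simp
      moreover have "J \<subseteq> insert j0 D" using j0 by auto
      ultimately show "\<forall>j\<in>J. f j = 0" using fD by auto
    qed
    with 2 show ?thesis by simp
  next
    case 3
    \<comment> \<open>On the rows in \<open>I\<close>, every column outside \<open>D\<close> is all
      ones: a hole in column \<open>a\<close> at a row of \<open>I\<close> would put
      \<open>a\<close> into \<open>D\<close>. The columns \<open>a\<close> and \<open>b\<close>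
      therefore agree and add up to zero.\<close>
    then obtain a b where ab: "a \<in> J - D" "b \<in> J - D" "a \<noteq> b"
      by (metis card_le_Suc0_iff_eq fin(2) finite_Diff not_less_eq_eq numeral_2_eq_2)
    define f :: "nat \<Rightarrow> bit" where "f = (\<lambda>j. if j = a \<or> j = b then 1 else 0)"
    have "sum f J = sum f {a, b}"
      using ab fin by (intro sum.mono_neutral_right) (auto simp: f_def)
    also have "\<dots> = 0" using ab by (simp add: f_def)
    finally have "\<forall>i\<in>I. sum f J = (if i \<in> D then f i else 0)" using ab by (auto simp: f_def)
    moreover have "f a \<noteq> 0" by (simp add: f_def)
    ultimately have "\<not> ?L" unfolding L using ab by blast
    moreover have "\<not> (I = J \<and> 0 \<notin> I)" using ab by (auto simp: D_def)
    ultimately show ?thesis using 3 cardD by auto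
  qed
qed

section \<open>Counting the pairs of index sets\<close>

lemma card_pairs_diagonal:
  "card {(I, J). I \<subseteq> {..<s} \<and> card I = t \<and> J \<subseteq> {..<s} \<and> card J = t \<and> I = J \<and> 0 \<notin> I}
    = (s - 1) choose t" (is "card ?X = _")
proof -
  have "?X = (\<lambda>I. (I, I)) ` {I. I \<subseteq> {1..<s} \<and> card I = t}"
    by (fastforce simp: image_iff subset_iff Suc_le_eq intro: gr0I)
  then show ?thesis by (simp add: card_image inj_on_def n_subsets)
qed

text \<open>Fix a \<open>(t - 1)\<close>-subset \<open>D\<close> of the nonzero indices. The pairs
  with \<open>I \<inter> J - {0} = D\<close> arise by adding to \<open>D\<close> one row
  \<open>i\<close> and one column \<open>j\<close> from the \<open>s - t + 1\<close> indices outside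
  \<open>D\<close>. If \<open>i = j\<close>, this common index lies in both sets but not in
  \<open>D\<close>, so it is 0. This leaves \<open>(s - t + 1) * (s - t)\<close> choices with
  distinct \<open>i\<close> and \<open>j\<close>, and one more.\<close>

lemma card_pairs_near_diagonal:
  assumes t: "1 \<le> t" "t \<le> s"
  shows "card {(I, J). I \<subseteq> {..<s} \<and> card I = t \<and> J \<subseteq> {..<s} \<and> card J = t
      \<and> card (I \<inter> J - {0}) = t - 1}
    = ((s - 1) choose (t - 1)) * (1 + (s - t + 1) * (s - t))" (is "card ?X = _")
proof -
  define Ds where "Ds = {D. D \<subseteq> {1..<s} \<and> card D = t - 1}"
  define P where "P D = insert (0, 0) {(i, j). i \<in> {..<s} - D \<and> j \<in> {..<s} - D \<and> i \<noteq> j}"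
    for D :: "nat set"
  define F where "F = (\<lambda>(D, i, j). (insert i D, insert j D :: nat set))"
  have finDs: "finite Ds" unfolding Ds_def by simp
  have cardP: "finite (P D) \<and> card (P D) = 1 + (s - t + 1) * (s - t)" if "D \<in> Ds" for D
  proof -
    let ?C = "{..<s} - D"
    have "D \<subseteq> {..<s}" "finite D" "card D = t - 1"
      using that finite_subset by (auto simp: Ds_def)
    then have C: "card ?C = s - t + 1" using t by (simp add: card_Diff_subset)
    have eq: "{(i, j). i \<in> ?C \<and> j \<in> ?C \<and> i \<noteq> j} = Sigma ?C (\<lambda>i. ?C - {i})" by auto
    have "card (Sigma ?C (\<lambda>i. ?C - {i})) = (\<Sum>i\<in>?C. s - t)"
      by (subst card_SigmaI) (auto simp: C)
    also have "\<dots> = (s - t + 1) * (s - t)" using C by simp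
    finally have "card (Sigma ?C (\<lambda>i. ?C - {i})) = (s - t + 1) * (s - t)" .
    then show ?thesis unfolding P_def eq by (subst card_insert_disjoint) auto
  qed
  have notin: "0 \<notin> D" "i \<notin> D" "j \<notin> D" "i = j \<longrightarrow> i = 0"
    if "D \<in> Ds" "(i, j) \<in> P D" for D i j
    using that by (auto simp: Ds_def P_def)
  have inter: "insert i D \<inter> insert j D - {0} = D"
    and diff: "insert i D - D = {i}" "insert j D - D = {j}"
    if "D \<in> Ds" "(i, j) \<in> P D" for D i j
    using notin[OF that] by auto
  \<comment> \<open>A pair determines \<open>D\<close> as its intersection without 0, and then
    \<open>i\<close> and \<open>j\<close> as the single elements left over.\<close>
  have "inj_on F (Sigma Ds P)"
  proof (rule inj_onI)
    fix x y assume x: "x \<in> Sigma Ds P" and y: "y \<in> Sigma Ds P" and eq: "F x = F y"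
    obtain D i j where x': "x = (D, i, j)" by (cases x)
    obtain E k l where y': "y = (E, k, l)" by (cases y)
    have D: "D \<in> Ds" "(i, j) \<in> P D" and E: "E \<in> Ds" "(k, l) \<in> P E" using x y x' y' by auto
    have ins: "insert i D = insert k E" "insert j D = insert l E"
      using eq x' y' by (simp_all add: F_def)
    then have "D = E" using inter[OF D] inter[OF E] by simp
    moreover have "{i} = {k}" "{j} = {l}" using diff[OF D] diff[OF E] ins \<open>D = E\<close> by metis+
    ultimately show "x = y" using x' y' by simp
  qed
  moreover have "F ` Sigma Ds P = ?X"
  proof (intro equalityI subsetI)
    fix z assume "z \<in> F ` Sigma Ds P"
    then obtain D i j where D: "D \<in> Ds" "(i, j) \<in> P D" and z: "z = F (D, i, j)" by auto
    have "finite D" using D finite_subset by (auto simp: Ds_def)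
    moreover have "D \<subseteq> {..<s}" "card D = t - 1" using D by (auto simp: Ds_def)
    moreover have "i < s" "j < s" using D t by (auto simp: P_def)
    moreover have "insert i D \<inter> insert j D - {0} = D"
      by (rule inter[OF D])
    ultimately show "z \<in> ?X" using notin[OF D] t by (simp add: z F_def)
  next
    fix z assume "z \<in> ?X"
    then obtain I J where z: "z = (I, J)" and I: "I \<subseteq> {..<s}" "card I = t"
      and J: "J \<subseteq> {..<s}" "card J = t" and c: "card (I \<inter> J - {0}) = t - 1" by auto
    define D where "D = I \<inter> J - {0}"
    have fin: "finite I" "finite J" using I J finite_subset by blast+
    then have "card (I - D) = card I - card D" "card (J - D) = card J - card D"
      by (auto simp: D_def intro!: card_Diff_subset)
    then have "card (I - D) = 1" "card (J - D) = 1" using c t I J by (auto simp: D_def)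
    then obtain i j where i: "I - D = {i}" and j: "J - D = {j}" by (meson card_1_singletonE)
    have IJ: "I = insert i D" "J = insert j D" using i j by (auto simp: D_def)
    have "D \<in> Ds" using c I by (auto simp: D_def Ds_def Suc_le_eq)
    moreover have "(i, j) \<in> P D" using i j I J by (auto simp: P_def D_def)
    ultimately show "z \<in> F ` Sigma Ds P" using z IJ by (force simp: F_def)
  qed
  ultimately have "card ?X = card (Sigma Ds P)" by (metis card_image)
  also have "\<dots> = (\<Sum>D\<in>Ds. card (P D))" using finDs cardP by (intro card_SigmaI) auto
  also have "\<dots> = card Ds * (1 + (s - t + 1) * (s - t))" using cardP by simp
  also have "card Ds = (s - 1) choose (t - 1)" by (simp add: Ds_def n_subsets)
  finally show ?thesis .
qed

theorem theorem3p8: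
  fixes s t :: nat and M :: "nat mat"
  assumes "1 \<le> t" and "t \<le> s - 1"
    and "M = mat s s (\<lambda>(i, j). if i = j \<and> 1 \<le> i then 0 else 1)"
  shows "(odd t \<longrightarrow>
            num_inv_submat t M = ((s - 1) choose (t - 1)) * (1 + (s - t + 1) * (s - t))) \<and>
         (even t \<longrightarrow>
            num_inv_submat t M =
              ((s - 1) choose t) + ((s - 1) choose (t - 1)) * (1 + (s - t + 1) * (s - t)))"
proof -
  define X where "X = {(I, J). I \<subseteq> {..<s} \<and> card I = t \<and> J \<subseteq> {..<s} \<and> card J = t
      \<and> card (I \<inter> J - {0}) = t - 1}"
  define Y where "Y = {(I, J). I \<subseteq> {..<s} \<and> card I = t \<and> J \<subseteq> {..<s} \<and> card J = t
      \<and> I = J \<and> 0 \<notin> I}"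
  have "num_inv_submat t M = card {(I, J). I \<subseteq> {..<s} \<and> card I = t \<and> J \<subseteq> {..<s} \<and> card J = t
      \<and> (card (I \<inter> J - {0}) = t - 1 \<or> even t \<and> I = J \<and> 0 \<notin> I)}"
    unfolding num_inv_submat_def assms(3) dim_row_mat dim_col_mat
    using holed_ones_submatrix_invertible_iff[OF _ _ _ _ assms(1)]
    by (intro arg_cong[where f = card] Collect_cong) (auto simp del: One_nat_def)
  also have "{(I, J). I \<subseteq> {..<s} \<and> card I = t \<and> J \<subseteq> {..<s} \<and> card J = t
      \<and> (card (I \<inter> J - {0}) = t - 1 \<or> even t \<and> I = J \<and> 0 \<notin> I)} =
      X \<union> (if even t then Y else {})"
    by (auto simp: X_def Y_def)
  finally have num: "num_inv_submat t M = card (X \<union> (if even t then Y else {}))" .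
  have "finite X" "finite Y"
    by (rule finite_subset[of _ "Pow {..<s} \<times> Pow {..<s}"]; auto simp: X_def Y_def)+
  \<comment> \<open>For a pair in \<open>Y\<close> the set \<open>I \<inter> J - {0}\<close> is
    \<open>I\<close>, of size \<open>t\<close>, which differs from \<open>t - 1\<close> because
    \<open>t\<close> is positive.\<close>
  moreover have "X \<inter> Y = {}" using assms(1) by (auto simp: X_def Y_def)
  ultimately have "card (X \<union> Y) = card Y + card X" by (simp add: card_Un_disjoint)
  moreover have "card X = ((s - 1) choose (t - 1)) * (1 + (s - t + 1) * (s - t))"
    unfolding X_def using assms by (intro card_pairs_near_diagonal) auto
  moreover have "card Y = (s - 1) choose t" unfolding Y_def by (rule card_pairs_diagonal)
  ultimately show ?thesis using num by auto
qed

end
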